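(* Let $F$ be a field of characteristic $0$, $G$ a finite group, and let $W,V,V'$ be projective monomial representations of $G$ over $F$, all with the same 2-cocycle, with monomial bases $M_W, M_V, M_{V'}$ respectively. Assume $\mathrm{Hom}_M(V,V')=0$. Let $P_1,\dots,P_r$ be an $F$-basis of $\mathrm{Hom}_M(W,V)$ and $Q_1,\dots,Q_s$ an $F$-basis of $\mathrm{Hom}_M(W,V')$, each consisting of $\{0,-1,1\}$-matrices with pairwise disjoint supports, each supported on a single $G$-orbit of index pairs. Let $x_1,\dots,x_r,y_1,\dots,y_s$ be distinct, not necessarily commuting, indeterminates and put $$A=\sum_{i=1}^r x_iP_i,\qquad B=\sum_{j=1}^s y_jQ_j .$$ Then $(A,B)$ is a Formal Orthogonal Pair with respect to the sets of indeterminates $I=\{x_1,\dots,x_r\}$ and $J=\{y_1,\dots,y_s\}$; in particular $AB^T=0$ over $\mathbb{Z}\{I\cup J\}$.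
   Context: A projective representation of a finite group $G$ over a field $F$ is a finite-dimensional $F$-vector space $V$ with a map $\rho:G\to GL(V)$ such that $\rho(gg')=\omega(g,g')\rho(g)\rho(g')$ for all $g,g'\in G$, where $\omega:G\times G\to\{\pm1\}$ is a 2-cocycle, called the cocycle of $V$. Write $gv$ for $\rho(g)v$. It is monomial, with monomial basis $M$, if $M$ is a basis of $V$ such that for every $g\in G$ and $m\in M$ one has $gm=\pm m'$ for some $m'\in M$. Ignoring signs, $G$ acts by permutations on $M$. A morphism between projective representations with the same cocycle is an $F$-linear map commuting with the action of every $g\in G$. For projective monomial representations $V,V'$ with the same cocycle and monomial bases $M_V,M_{V'}$, $\mathrm{Hom}_M(V,V')$ denotes the $F$-space of matrices representing morphisms $T:V\to V'$ with respect to the monomial bases, with rows indexed by the basis of the target $V'$ and columns by the basis of the source $V$. The orbits of index pairs are the orbits of the diagonal (sign-ignoring) action of $G$ on pairs (row index, column index). Formal Orthogonal Pair: Let $I,J$ be finite disjoint sets of (not necessarily commuting) indeterminates. A Formal Orthogonal Pair is a pair $(A,B)$ of rectangular matrices such that (i) the entries of $A$ are $\pm i$ with $i\in I\cup\{0\}$; (ii) the entries of $B$ are $\pm j$ with $j\in J\cup\{0\}$; (iii) $AB^T=0$, where this equality is over the non-commutative ring $\mathbb{Z}\{I\cup J\}$ generated freely over $\mathbb{Z}$ by the symbols in $I\cup J$, and $B^T$ is the plain transpose. The $\{0,-1,1\}$-matrices $P_i,Q_j$ are regarded as integer matrices when forming $A$ and $B$. *)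

theory Defs
  imports
    Complex_Main
    "HOL-Algebra.Group_Action"
    "HOL-Library.Poly_Mapping"
    "HOL-Library.Function_Algebras"
    "HOL-Library.Disjoint_Sets"
begin

section \<open>The free ring over the integers\<close>

text \<open>The monoid ring over \<open>int\<close> of the free monoid on \<open>'x\<close>. Since \<^typ>\<open>('a, 'b) poly_mapping\<close>
  convolves along addition of exponents, the free monoid is written additively, although it is not
  commutative.\<close>

datatype 'x free_monoid = Word "'x list"

instantiation free_monoid :: (type) monoid_add
begin

definition zero_free_monoid :: "'x free_monoid" where
  "zero_free_monoid = Word []"

fun plus_free_monoid :: "'x free_monoid \<Rightarrow> 'x free_monoid \<Rightarrow> 'x free_monoid" where
  "plus_free_monoid (Word u) (Word v) = Word (u @ v)"

instance
proof
  fix a b c :: "'x free_monoid"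
  show "a + b + c = a + (b + c)"
    by (cases a; cases b; cases c) simp
  show "0 + a = a" "a + 0 = a"
    by (cases a; simp add: zero_free_monoid_def)+
qed

end

type_synonym 'x free_ring = "'x free_monoid \<Rightarrow>\<^sub>0 int"

definition indet :: "'x \<Rightarrow> 'x free_ring" where
  "indet a = Poly_Mapping.single (Word [a]) 1"


section \<open>Matrices with arbitrary index sets\<close>

text \<open>A matrix is a function of its row index and its column index; index sets are given
  separately where they matter. The additive structure is the pointwise one.\<close>

definition mat_scale :: "'f::field \<Rightarrow> ('r \<Rightarrow> 'c \<Rightarrow> 'f) \<Rightarrow> 'r \<Rightarrow> 'c \<Rightarrow> 'f" where
  "mat_scale c X = (\<lambda>a b. c * X a b)"

interpretation matrices: vector_space "mat_scale :: 'f::field \<Rightarrow> ('r \<Rightarrow> 'c \<Rightarrow> 'f) \<Rightarrow> _"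
  by unfold_locales (auto simp: mat_scale_def fun_eq_iff algebra_simps)

definition mat_support :: "('r \<Rightarrow> 'c \<Rightarrow> 'f::zero) \<Rightarrow> ('r \<times> 'c) set" where
  "mat_support X = {(a, b). X a b \<noteq> 0}"

definition mat_mult :: "'k set \<Rightarrow> ('r \<Rightarrow> 'k \<Rightarrow> 'a) \<Rightarrow> ('k \<Rightarrow> 'c \<Rightarrow> 'a) \<Rightarrow> 'r \<Rightarrow> 'c \<Rightarrow> 'a::semiring_0"
  where "mat_mult K X Y = (\<lambda>a b. \<Sum>k\<in>K. X a k * Y k b)"

definition mat_transpose :: "('r \<Rightarrow> 'c \<Rightarrow> 'a) \<Rightarrow> 'c \<Rightarrow> 'r \<Rightarrow> 'a" where
  "mat_transpose X = (\<lambda>b a. X a b)"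


section \<open>Formal Orthogonal Pairs\<close>

text \<open>\<open>A\<close> is a matrix with rows \<open>R\<close> and columns \<open>C\<close>, and \<open>B\<close> one with rows \<open>S\<close> and columns \<open>C\<close>.
  By the conditions on the entries, the product lies in the subring generated by \<open>I \<union> J\<close>, which is
  free on \<open>I \<union> J\<close>; so it does not matter that the ambient ring is free on the whole type \<open>'x\<close>.\<close>

definition formal_orthogonal_pair ::
  "'x set \<Rightarrow> 'x set \<Rightarrow> 'r set \<Rightarrow> 's set \<Rightarrow> 'c set \<Rightarrow>
   ('r \<Rightarrow> 'c \<Rightarrow> 'x free_ring) \<Rightarrow> ('s \<Rightarrow> 'c \<Rightarrow> 'x free_ring) \<Rightarrow> bool" where
  "formal_orthogonal_pair I J R S C A B \<longleftrightarrow>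
     finite I \<and> finite J \<and> I \<inter> J = {} \<and> finite R \<and> finite S \<and> finite C \<and>
     (\<forall>a\<in>R. \<forall>c\<in>C. A a c = 0 \<or> (\<exists>i\<in>I. A a c = indet i \<or> A a c = - indet i)) \<and>
     (\<forall>b\<in>S. \<forall>c\<in>C. B b c = 0 \<or> (\<exists>j\<in>J. B b c = indet j \<or> B b c = - indet j)) \<and>
     (\<forall>a\<in>R. \<forall>b\<in>S. mat_mult C A (mat_transpose B) a b = 0)"


section \<open>Projective monomial representations\<close>

definition sign_cocycle :: "('g, 'e) monoid_scheme \<Rightarrow> ('g \<Rightarrow> 'g \<Rightarrow> 'f::field) \<Rightarrow> bool" where
  "sign_cocycle G \<omega> \<longleftrightarrow>
     (\<forall>g\<in>carrier G. \<forall>h\<in>carrier G. \<omega> g h \<in> {1, -1}) \<and>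
     (\<forall>g\<in>carrier G. \<forall>h\<in>carrier G. \<forall>k\<in>carrier G.
        \<omega> g h * \<omega> (g \<otimes>\<^bsub>G\<^esub> h) k = \<omega> h k * \<omega> g (h \<otimes>\<^bsub>G\<^esub> k))"

text \<open>The underlying vector space is the whole type \<open>'v\<close> with scalar multiplication \<open>scale\<close>.\<close>

locale projective_rep = grp: group G + vs: vector_space scale
  for G :: "('g, 'e) monoid_scheme" (structure)
  and scale :: "'f::field \<Rightarrow> 'v::ab_group_add \<Rightarrow> 'v" +
  fixes \<omega> :: "'g \<Rightarrow> 'g \<Rightarrow> 'f"
  and \<rho> :: "'g \<Rightarrow> 'v \<Rightarrow> 'v"
  assumes finite_group: "finite (carrier G)"
  and finite_dim: "\<exists>S. finite S \<and> vs.span S = UNIV"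
  and cocycle: "sign_cocycle G \<omega>"
  and rep_linear: "g \<in> carrier G \<Longrightarrow> Vector_Spaces.linear scale scale (\<rho> g)"
  and rep_bij: "g \<in> carrier G \<Longrightarrow> bij (\<rho> g)"
  and rep_mult: "g \<in> carrier G \<Longrightarrow> h \<in> carrier G \<Longrightarrow>
    \<rho> (g \<otimes> h) v = scale (\<omega> g h) (\<rho> g (\<rho> h v))"

locale projective_monomial_rep = projective_rep G scale \<omega> \<rho>
  for G :: "('g, 'e) monoid_scheme" (structure)
  and scale :: "'f::field \<Rightarrow> 'v::ab_group_add \<Rightarrow> 'v"
  and \<omega> :: "'g \<Rightarrow> 'g \<Rightarrow> 'f"
  and \<rho> :: "'g \<Rightarrow> 'v \<Rightarrow> 'v" +
  fixes M :: "'v set"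
  assumes basis_independent: "vs.independent M"
  and basis_span: "vs.span M = UNIV"
  and monomial: "g \<in> carrier G \<Longrightarrow> m \<in> M \<Longrightarrow> \<exists>m'\<in>M. \<rho> g m = m' \<or> \<rho> g m = - m'"

text \<open>The action of \<open>G\<close> on a monomial basis up to sign. The description is unique because \<open>M\<close> is
  linearly independent.\<close>

definition basis_act :: "('g \<Rightarrow> 'v \<Rightarrow> 'v::ab_group_add) \<Rightarrow> 'v set \<Rightarrow> 'g \<Rightarrow> 'v \<Rightarrow> 'v" where
  "basis_act \<rho> M g m = (THE m'. m' \<in> M \<and> (\<rho> g m = m' \<or> \<rho> g m = - m'))"

definition pair_act ::
  "('g \<Rightarrow> 'r \<Rightarrow> 'r::ab_group_add) \<Rightarrow> 'r set \<Rightarrow> ('g \<Rightarrow> 'c \<Rightarrow> 'c::ab_group_add) \<Rightarrow> 'c set \<Rightarrow>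
   'g \<Rightarrow> 'r \<times> 'c \<Rightarrow> 'r \<times> 'c" where
  "pair_act \<rho> M \<sigma> N g = (\<lambda>(a, b). (basis_act \<rho> M g a, basis_act \<sigma> N g b))"

definition rep_morphism ::
  "('g, 'e) monoid_scheme \<Rightarrow> ('f::field \<Rightarrow> 'v::ab_group_add \<Rightarrow> 'v) \<Rightarrow> ('g \<Rightarrow> 'v \<Rightarrow> 'v) \<Rightarrow>
   ('f \<Rightarrow> 'w::ab_group_add \<Rightarrow> 'w) \<Rightarrow> ('g \<Rightarrow> 'w \<Rightarrow> 'w) \<Rightarrow> ('v \<Rightarrow> 'w) \<Rightarrow> bool" where
  "rep_morphism G s \<rho> s' \<rho>' T \<longleftrightarrow>
     Vector_Spaces.linear s s' T \<and> (\<forall>g\<in>carrier G. \<forall>v. T (\<rho> g v) = \<rho>' g (T v))"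

text \<open>The matrix of \<open>T\<close> with respect to the basis \<open>M\<close> of the source and the basis \<open>M'\<close> of the target,
  extended by zero outside \<open>M' \<times> M\<close>; recall that \<open>module.representation s' M' v m'\<close> is the coordinate
  of \<open>v\<close> at \<open>m'\<close>, and zero if \<open>m'\<close> is not in \<open>M'\<close>.\<close>

definition matrix_wrt ::
  "'v set \<Rightarrow> ('f::field \<Rightarrow> 'w::ab_group_add \<Rightarrow> 'w) \<Rightarrow> 'w set \<Rightarrow> ('v \<Rightarrow> 'w) \<Rightarrow> 'w \<Rightarrow> 'v \<Rightarrow> 'f" where
  "matrix_wrt M s' M' T =
     (\<lambda>m' m. if m \<in> M then module.representation s' M' (T m) m' else 0)"

definition Hom_M ::
  "('g, 'e) monoid_scheme \<Rightarrow>
   ('f::field \<Rightarrow> 'v::ab_group_add \<Rightarrow> 'v) \<Rightarrow> ('g \<Rightarrow> 'v \<Rightarrow> 'v) \<Rightarrow> 'v set \<Rightarrow>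
   ('f \<Rightarrow> 'w::ab_group_add \<Rightarrow> 'w) \<Rightarrow> ('g \<Rightarrow> 'w \<Rightarrow> 'w) \<Rightarrow> 'w set \<Rightarrow> ('w \<Rightarrow> 'v \<Rightarrow> 'f) set" where
  "Hom_M G s \<rho> M s' \<rho>' M' = matrix_wrt M s' M' ` {T. rep_morphism G s \<rho> s' \<rho>' T}"


section \<open>Families of sign matrices\<close>

definition is_basis_family :: "('r \<Rightarrow> 'c \<Rightarrow> 'f::field) set \<Rightarrow> nat \<Rightarrow> (nat \<Rightarrow> 'r \<Rightarrow> 'c \<Rightarrow> 'f) \<Rightarrow> bool"
  where
  "is_basis_family H r P \<longleftrightarrow>
     inj_on P {1..r} \<and> matrices.independent (P ` {1..r}) \<and> matrices.span (P ` {1..r}) = H"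

definition sign_orbit_family ::
  "('g, 'e) monoid_scheme \<Rightarrow>
   ('g \<Rightarrow> 'r \<Rightarrow> 'r::ab_group_add) \<Rightarrow> 'r set \<Rightarrow> ('g \<Rightarrow> 'c \<Rightarrow> 'c::ab_group_add) \<Rightarrow> 'c set \<Rightarrow>
   nat \<Rightarrow> (nat \<Rightarrow> 'r \<Rightarrow> 'c \<Rightarrow> 'f::field) \<Rightarrow> bool" where
  "sign_orbit_family G \<rho> M \<sigma> N r P \<longleftrightarrow>
     (\<forall>i\<in>{1..r}. \<forall>a\<in>M. \<forall>b\<in>N. P i a b \<in> {0, -1, 1}) \<and>
     disjoint_family_on (\<lambda>i. mat_support (P i)) {1..r} \<and>
     (\<forall>i\<in>{1..r}. \<exists>p\<in>M \<times> N. mat_support (P i) \<subseteq> orbit G (pair_act \<rho> M \<sigma> N) p)"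

text \<open>The matrix \<open>\<Sum>\<^sub>i x\<^sub>i P\<^sub>i\<close> over the free ring. The entries of the \<open>P\<^sub>i\<close> lie in a field of
  characteristic zero; \<open>the_inv of_int\<close> takes the entries, which are to be integers, back to \<open>int\<close>.\<close>

definition formal_combination ::
  "nat \<Rightarrow> (nat \<Rightarrow> 'x) \<Rightarrow> (nat \<Rightarrow> 'r \<Rightarrow> 'c \<Rightarrow> 'f::field_char_0) \<Rightarrow> 'r \<Rightarrow> 'c \<Rightarrow> 'x free_ring" where
  "formal_combination r x P =
     (\<lambda>a b. \<Sum>i=1..r. indet (x i) * of_int (the_inv (of_int :: int \<Rightarrow> 'f) (P i a b)))"

end

theory Submission
  imports Defs
begin

text \<open>A monomial representation acts by signed permutation matrices, which are orthogonal. Hence a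
  matrix \<open>X\<close> represents a morphism iff it is invariant under simultaneous signed permutations of
  its rows and columns, a condition symmetric under transposition. So \<open>Q\<^sub>j P\<^sub>i\<^sup>T\<close> represents a
  morphism \<open>V \<rightarrow> V'\<close> and therefore vanishes; these matrices are the coefficients of the
  monomials \<open>x\<^sub>i y\<^sub>j\<close> in \<open>A B\<^sup>T\<close>.\<close>

section \<open>Signed permutations of a monomial basis\<close>

definition signed_perm_on ::
  "('f::field \<Rightarrow> 'v::ab_group_add \<Rightarrow> 'v) \<Rightarrow> 'v set \<Rightarrow> ('v \<Rightarrow> 'v) \<Rightarrow> ('v \<Rightarrow> 'v) \<Rightarrow> ('v \<Rightarrow> 'f) \<Rightarrow> bool"
  where
  "signed_perm_on scale M f p e \<longleftrightarrow>
     bij_betw p M M \<and> (\<forall>m\<in>M. e m * e m = 1 \<and> f m = scale (e m) (p m))"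

text \<open>Let \<open>D\<close> be the signed permutation matrix with entry \<open>e a\<close> at
  \<open>(p a, a)\<close>, and \<open>E\<close> the one with entry \<open>d c\<close> at
  \<open>(q c, c)\<close>. For permutations \<open>p\<close> of \<open>R\<close> and
  \<open>q\<close> of \<open>C\<close> the condition is the entrywise form of D X E^T = X. It treats
  rows and columns alike, which is what makes it compatible with transposition.\<close>

definition signed_invariant ::
  "'r set \<Rightarrow> ('r \<Rightarrow> 'r) \<Rightarrow> ('r \<Rightarrow> 'f::field) \<Rightarrow> 'c set \<Rightarrow> ('c \<Rightarrow> 'c) \<Rightarrow> ('c \<Rightarrow> 'f) \<Rightarrow>
   ('r \<Rightarrow> 'c \<Rightarrow> 'f) \<Rightarrow> bool" where
  "signed_invariant R p e C q d X \<longleftrightarrow>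
     (\<forall>a\<in>R. \<forall>c\<in>C. X (p a) (q c) = e a * d c * X a c)"

lemma (in vector_space) independent_eq_if_scaled:
  assumes "independent M" "m \<in> M" "n \<in> M" "m = scale c n"
  shows "m = n"
proof (rule ccontr)
  assume "m \<noteq> n"
  then have "m \<in> span (M - {m})"
    using assms by (metis span_base span_scale insertE insert_Diff)
  then show False
    using assms(1,2) dependent_def by blast
qed

lemma (in projective_monomial_rep) finite_basis: "finite M"
proof -
  obtain S where "finite S" "vs.span S = UNIV"
    using finite_dim by blast
  then show ?thesis
    using vs.independent_span_bound[of S M] basis_independent by auto
qed

text \<open>Monomiality gives only a map \<open>p\<close> from \<open>M\<close> to itself. If
  \<open>p m = p n\<close>, then the images of \<open>m\<close> and \<open>n\<close> under
  \<open>\<rho> g\<close> are proportional, hence so are \<open>m\<close> and \<open>n\<close>, and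
  independence forces them to be equal. Finiteness of \<open>M\<close> upgrades injectivity to
  bijectivity.\<close>

lemma (in projective_monomial_rep) signed_perm_exists:
  assumes g: "g \<in> carrier G"
  obtains p e where "signed_perm_on scale M (\<rho> g) p e"
proof -
  \<comment> \<open>A sign is recorded as a scalar that is its own inverse; this is the form in
    which signs are cancelled or moved across equations below.\<close>
  have "\<exists>m' c. m' \<in> M \<and> c * c = 1 \<and> \<rho> g m = scale c m'" if m: "m \<in> M" for m
  proof -
    obtain m' where m': "m' \<in> M" "\<rho> g m = m' \<or> \<rho> g m = - m'"
      using monomial[OF g m] by blast
    have "\<rho> g m = scale 1 m' \<or> \<rho> g m = scale (-1) m'"
      using m'(2) by simp
    then show ?thesis
      using m'(1) by (metis mult_1 mult_minus1 minus_minus)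
  qed
  then obtain p e where pe: "\<And>m. m \<in> M \<Longrightarrow> p m \<in> M \<and> e m * e m = 1 \<and> \<rho> g m = scale (e m) (p m)"
    by metis
  interpret lin: Vector_Spaces.linear scale scale "\<rho> g"
    by (rule rep_linear[OF g])
  have "inj_on p M"
  proof (rule inj_onI)
    fix m n assume mn: "m \<in> M" "n \<in> M" "p m = p n"
    have "\<rho> g n = scale (e n) (p n)" "e n * e n = 1"
      using pe mn by auto
    then have "p n = scale (e n) (\<rho> g n)"
      by simp
    then have "\<rho> g m = \<rho> g (scale (e m * e n) n)"
      using pe[of m] mn by (simp add: lin.scale)
    then have "m = scale (e m * e n) n"
      using rep_bij[OF g] by (meson bij_is_inj injD)
    then show "m = n"
      using vs.independent_eq_if_scaled basis_independent mn by blast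
  qed
  moreover have "p ` M \<subseteq> M"
    using pe by blast
  ultimately have "bij_betw p M M"
    using endo_inj_surj[OF finite_basis] unfolding bij_betw_def by blast
  then show thesis
    using that[of p e] pe unfolding signed_perm_on_def by blast
qed

lemma (in projective_monomial_rep) representation_signed_perm:
  assumes lin: "Vector_Spaces.linear scale scale f"
    and sp: "signed_perm_on scale M f p e" and m: "m \<in> M"
  shows "vs.representation M (f v) (p m) = e m * vs.representation M v m"
proof -
  interpret lin: Vector_Spaces.linear scale scale f
    by (rule lin)
  have inj: "inj_on p M" and pM: "\<And>n. n \<in> M \<Longrightarrow> p n \<in> M"
    using sp unfolding signed_perm_on_def bij_betw_def by auto
  have "v = (\<Sum>n\<in>M. scale (vs.representation M v n) n)"
    using vs.sum_representation_eq[OF basis_independent _ finite_basis, of v] basis_span by simp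
  then have "f v = f (\<Sum>n\<in>M. scale (vs.representation M v n) n)"
    by simp
  also have "\<dots> = (\<Sum>n\<in>M. scale (vs.representation M v n * e n) (p n))"
    unfolding lin.sum using sp
    by (intro sum.cong) (auto simp: lin.scale signed_perm_on_def)
  finally have "vs.representation M (f v) (p m) =
      (\<Sum>n\<in>M. vs.representation M (scale (vs.representation M v n * e n) (p n)) (p m))"
    by (simp add: vs.representation_sum[OF basis_independent] basis_span)
  \<comment> \<open>Since \<open>p\<close> is injective, \<open>p n\<close> contributes to the
    coordinate at \<open>p m\<close> only for \<open>n = m\<close>.\<close>
  also have "\<dots> = (\<Sum>n\<in>M. if n = m then vs.representation M v n * e n else 0)"
    using inj pM m
    by (intro sum.cong)
      (auto simp: vs.representation_scale[OF basis_independent] basis_span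
        vs.representation_basis[OF basis_independent] inj_on_eq_iff)
  finally show ?thesis
    using m finite_basis by (simp add: mult.commute)
qed

section \<open>Morphisms as invariant matrices\<close>

text \<open>By linearity, commuting with the action of \<open>g\<close> can be tested on basis
  vectors \<open>m\<close>. Comparing the coordinates at \<open>p' n\<close> of both sides gives one
  equation between entries of the matrix for each pair of basis vectors, and these equations are the
  signed invariance.\<close>

lemma morphism_matrix_iff:
  assumes V: "projective_monomial_rep G s \<omega> \<rho> M"
    and V': "projective_monomial_rep G s' \<omega>' \<rho>' M'"
    and T: "Vector_Spaces.linear s s' T"
    and g: "g \<in> carrier G"
    and p: "signed_perm_on s M (\<rho> g) p e" and p': "signed_perm_on s' M' (\<rho>' g) p' e'"
  shows "(\<forall>v. T (\<rho> g v) = \<rho>' g (T v)) \<longleftrightarrow>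
    signed_invariant M' p' e' M p e (matrix_wrt M s' M' T)"
proof -
  interpret V: projective_monomial_rep G s \<omega> \<rho> M by (rule V)
  interpret V': projective_monomial_rep G s' \<omega>' \<rho>' M' by (rule V')
  interpret VV': vector_space_pair s s' ..
  interpret T: Vector_Spaces.linear s s' T by (rule T)
  interpret lin: Vector_Spaces.linear s s "\<rho> g" by (rule V.rep_linear[OF g])
  interpret lin': Vector_Spaces.linear s' s' "\<rho>' g" by (rule V'.rep_linear[OF g])
  let ?X = "matrix_wrt M s' M' T"
  let ?rep = "V'.vs.representation M'"
  have pM: "p m \<in> M" and e: "e m * e m = 1" and \<rho>: "\<rho> g m = s (e m) (p m)" if "m \<in> M" for m
    using p that unfolding signed_perm_on_def bij_betw_def by auto
  have p'M: "p' ` M' = M'"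
    using p' unfolding signed_perm_on_def bij_betw_def by auto
  have left: "?rep (T (\<rho> g m)) n = e m * ?X n (p m)" if "m \<in> M" for m n
    using that pM V'.basis_span
    by (simp add: \<rho> T.scale matrix_wrt_def V'.vs.representation_scale[OF V'.basis_independent])
  have right: "?rep (\<rho>' g (T m)) (p' n) = e' n * ?X n m" if "m \<in> M" "n \<in> M'" for m n
    using that V'.representation_signed_perm[OF V'.rep_linear[OF g] p']
    by (simp add: matrix_wrt_def)
  \<comment> \<open>The coordinates of an image under \<open>\<rho>' g\<close> are known in the form
    \<open>p' n\<close>; as \<open>p'\<close> is onto \<open>M'\<close>, comparing coordinates there
    suffices.\<close>
  have rep_eq_iff: "u = v \<longleftrightarrow> (\<forall>n\<in>M'. ?rep u (p' n) = ?rep v (p' n))" for u v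
  proof
    assume "\<forall>n\<in>M'. ?rep u (p' n) = ?rep v (p' n)"
    then have eq: "\<forall>n\<in>M'. ?rep u n = ?rep v n"
      using p'M by (metis imageE)
    have "u = (\<Sum>n\<in>M'. s' (?rep u n) n)" for u
      using V'.vs.sum_representation_eq[OF V'.basis_independent _ V'.finite_basis, of u]
        V'.basis_span by simp
    then show "u = v"
      using eq by (metis (no_types, lifting) sum.cong)
  qed simp
  have "(\<forall>v. T (\<rho> g v) = \<rho>' g (T v)) \<longleftrightarrow> (\<forall>m\<in>M. T (\<rho> g m) = \<rho>' g (T m))"
  proof
    assume basis: "\<forall>m\<in>M. T (\<rho> g m) = \<rho>' g (T m)"
    have "Vector_Spaces.linear s s' (T \<circ> \<rho> g)" "Vector_Spaces.linear s s' (\<rho>' g \<circ> T)"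
      using Vector_Spaces.linear_compose[OF lin.linear_axioms T]
        Vector_Spaces.linear_compose[OF T lin'.linear_axioms] by auto
    then show "\<forall>v. T (\<rho> g v) = \<rho>' g (T v)"
      using VV'.linear_eq_on_span[of "T \<circ> \<rho> g" "\<rho>' g \<circ> T" M] basis V.basis_span by auto
  qed blast
  also have "\<dots> \<longleftrightarrow> (\<forall>m\<in>M. \<forall>n\<in>M'. e m * ?X (p' n) (p m) = e' n * ?X n m)"
    using rep_eq_iff left right by simp
  \<comment> \<open>The sign \<open>e m\<close> is its own inverse, so it passes to the other
    side.\<close>
  also have "\<dots> \<longleftrightarrow> (\<forall>m\<in>M. \<forall>n\<in>M'. ?X (p' n) (p m) = e' n * e m * ?X n m)"
  proof -
    have "e m * a = b \<longleftrightarrow> a = e m * b" if "m \<in> M" for m a b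
      using e[OF that] by (metis mult.assoc mult_1)
    then show ?thesis
      by (simp add: mult.assoc mult.left_commute)
  qed
  finally show ?thesis
    unfolding signed_invariant_def by blast
qed

text \<open>The columns prescribe the images of the basis \<open>M\<close>, and a linear extension
  exists by independence. Vanishing outside \<open>M' \<times> M\<close> matches the zero default of
  \<open>matrix_wrt\<close>, so that the two matrices agree as functions on the whole types.\<close>

lemma linear_of_matrix:
  assumes V: "projective_monomial_rep G s \<omega> \<rho> M"
    and V': "projective_monomial_rep G s' \<omega>' \<rho>' M'"
    and zero: "\<And>a b. a \<notin> M' \<or> b \<notin> M \<Longrightarrow> X a b = 0"
  obtains T where "Vector_Spaces.linear s s' T" "matrix_wrt M s' M' T = X"
proof -
  interpret V: projective_monomial_rep G s \<omega> \<rho> M by (rule V)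
  interpret V': projective_monomial_rep G s' \<omega>' \<rho>' M' by (rule V')
  interpret VV': vector_space_pair s s' ..
  obtain T where T: "Vector_Spaces.linear s s' T" "\<forall>m\<in>M. T m = (\<Sum>n\<in>M'. s' (X n m) n)"
    using VV'.linear_independent_extend[OF V.basis_independent, of "\<lambda>m. \<Sum>n\<in>M'. s' (X n m) n"]
    by blast
  have "matrix_wrt M s' M' T a b = X a b" for a b
  proof (cases "a \<in> M' \<and> b \<in> M")
    case True
    then have "V'.vs.representation M' (T b) a = (\<Sum>n\<in>M'. if a = n then X n b else 0)"
      using T(2) V'.basis_span
      by (simp add: V'.vs.representation_sum[OF V'.basis_independent]
          V'.vs.representation_scale[OF V'.basis_independent]
          V'.vs.representation_basis[OF V'.basis_independent] eq_commute[of a] if_distrib cong: if_cong)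
    then show ?thesis
      using True V'.finite_basis by (simp add: matrix_wrt_def)
  next
    case False
    then show ?thesis
      using zero V'.vs.representation_ne_zero[of M'] unfolding matrix_wrt_def by metis
  qed
  then show thesis
    using that T(1) by blast
qed

lemma Hom_M_signed_invariant:
  assumes V: "projective_monomial_rep G s \<omega> \<rho> M"
    and V': "projective_monomial_rep G s' \<omega>' \<rho>' M'"
    and X: "X \<in> Hom_M G s \<rho> M s' \<rho>' M'"
    and g: "g \<in> carrier G"
    and p: "signed_perm_on s M (\<rho> g) p e" and p': "signed_perm_on s' M' (\<rho>' g) p' e'"
  shows "signed_invariant M' p' e' M p e X"
proof -
  obtain T where "rep_morphism G s \<rho> s' \<rho>' T" "X = matrix_wrt M s' M' T"
    using X unfolding Hom_M_def by blast
  then show ?thesis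
    using morphism_matrix_iff[OF V V' _ g p p'] g unfolding rep_morphism_def by blast
qed

section \<open>Products with a transpose\<close>

text \<open>With signed permutation matrices D, D', E this is (D X E^T)(D' Y E^T)^T = D (X Y^T)
  D'^T, where E^T E = 1 by orthogonality. Entrywise, the sum is reindexed along \<open>q\<close> and
  the signs on \<open>K\<close> cancel.\<close>

lemma signed_invariant_mult_transpose:
  assumes q: "signed_perm_on s K f q d"
    and X: "signed_invariant R p e K q d X" and Y: "signed_invariant S p' e' K q d Y"
  shows "signed_invariant R p e S p' e' (mat_mult K X (mat_transpose Y))"
  unfolding signed_invariant_def
proof (intro ballI)
  fix a b assume ab: "a \<in> R" "b \<in> S"
  have bij: "bij_betw q K K" and d: "\<And>k. k \<in> K \<Longrightarrow> d k * d k = 1"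
    using q unfolding signed_perm_on_def by auto
  have "mat_mult K X (mat_transpose Y) (p a) (p' b) = (\<Sum>k\<in>K. X (p a) (q k) * Y (p' b) (q k))"
    unfolding mat_mult_def mat_transpose_def by (rule sum.reindex_bij_betw[OF bij, symmetric])
  also have "\<dots> = (\<Sum>k\<in>K. e a * e' b * (X a k * Y b k))"
  proof (rule sum.cong)
    fix k assume k: "k \<in> K"
    \<comment> \<open>The sign \<open>d k\<close> arises once from \<open>X\<close> and once from
      \<open>Y\<close>, hence as a square.\<close>
    have "X (p a) (q k) * Y (p' b) (q k) = (d k * d k) * (e a * e' b * (X a k * Y b k))"
      using X Y ab k unfolding signed_invariant_def by (simp add: ac_simps)
    then show "X (p a) (q k) * Y (p' b) (q k) = e a * e' b * (X a k * Y b k)"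
      using d[OF k] by simp
  qed simp
  finally show "mat_mult K X (mat_transpose Y) (p a) (p' b) =
      e a * e' b * mat_mult K X (mat_transpose Y) a b"
    by (simp add: mat_mult_def mat_transpose_def sum_distrib_left)
qed

text \<open>Transposition reverses the arrow of \<open>X\<close>, so the product of \<open>Y\<close>
  with the transpose of \<open>X\<close> runs from V through W to V'. It is cut off to zero outside
  \<open>MV' \<times> MV\<close> because every element of \<open>Hom_M\<close> vanishes
  there.\<close>

lemma Hom_M_mult_transpose:
  assumes W: "projective_monomial_rep G sW \<omega>W \<rho>W MW"
    and V: "projective_monomial_rep G sV \<omega>V \<rho>V MV"
    and V': "projective_monomial_rep G sV' \<omega>V' \<rho>V' MV'"
    and X: "X \<in> Hom_M G sW \<rho>W MW sV \<rho>V MV" and Y: "Y \<in> Hom_M G sW \<rho>W MW sV' \<rho>V' MV'"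
  shows "(\<lambda>a b. if a \<in> MV' \<and> b \<in> MV then mat_mult MW Y (mat_transpose X) a b else 0)
    \<in> Hom_M G sV \<rho>V MV sV' \<rho>V' MV'" (is "?Z \<in> _")
proof -
  \<comment> \<open>First the product is realised by a merely linear map; its equivariance is then
    read off from the invariance of its matrix.\<close>
  obtain T where T: "Vector_Spaces.linear sV sV' T" and mat_T: "matrix_wrt MV sV' MV' T = ?Z"
    by (rule linear_of_matrix[OF V V', of ?Z]) auto
  have "\<forall>v. T (\<rho>V g v) = \<rho>V' g (T v)" if g: "g \<in> carrier G" for g
  proof -
    obtain q d where q: "signed_perm_on sW MW (\<rho>W g) q d"
      using projective_monomial_rep.signed_perm_exists[OF W g] .
    obtain p e where p: "signed_perm_on sV MV (\<rho>V g) p e"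
      using projective_monomial_rep.signed_perm_exists[OF V g] .
    obtain p' e' where p': "signed_perm_on sV' MV' (\<rho>V' g) p' e'"
      using projective_monomial_rep.signed_perm_exists[OF V' g] .
    have "signed_invariant MV' p' e' MV p e (mat_mult MW Y (mat_transpose X))"
      using signed_invariant_mult_transpose[OF q]
        Hom_M_signed_invariant[OF W V' Y g q p'] Hom_M_signed_invariant[OF W V X g q p] by blast
    \<comment> \<open>The permutations preserve the index sets, so the cut-off does not disturb the
      invariance.\<close>
    moreover have "p' ` MV' = MV'" "p ` MV = MV"
      using p p' unfolding signed_perm_on_def bij_betw_def by auto
    ultimately have "signed_invariant MV' p' e' MV p e ?Z"
      unfolding signed_invariant_def by auto
    then show ?thesis
      using morphism_matrix_iff[OF V V' T g p p'] mat_T by simp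
  qed
  then have "rep_morphism G sV \<rho>V sV' \<rho>V' T"
    using T unfolding rep_morphism_def by blast
  then show ?thesis
    unfolding Hom_M_def mat_T[symmetric] by simp
qed

section \<open>Formal matrices over the free ring\<close>

lemma the_inv_of_int_simps [simp]:
  "the_inv (of_int :: int \<Rightarrow> 'f::ring_char_0) (of_int k) = k"
  "the_inv (of_int :: int \<Rightarrow> 'f) 0 = 0"
  "the_inv (of_int :: int \<Rightarrow> 'f) 1 = 1"
  "the_inv (of_int :: int \<Rightarrow> 'f) (- 1) = - 1"
proof -
  have inv: "the_inv (of_int :: int \<Rightarrow> 'f) (of_int k) = k" for k
    by (rule the_inv_f_f) (simp add: inj_def)
  show "the_inv (of_int :: int \<Rightarrow> 'f) (of_int k) = k"
    by (rule inv)
  show "the_inv (of_int :: int \<Rightarrow> 'f) 0 = 0" "the_inv (of_int :: int \<Rightarrow> 'f) 1 = 1"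
    "the_inv (of_int :: int \<Rightarrow> 'f) (- 1) = - 1"
    using inv[of 0] inv[of 1] inv[of "- 1"] by simp_all
qed

text \<open>Disjointness of the supports leaves at most one \<open>P i\<close> that is nonzero at
  \<open>(a, b)\<close>, so the sum collapses to a single indeterminate with a sign, or to
  zero.\<close>

lemma formal_combination_entry:
  fixes P :: "nat \<Rightarrow> 'r::ab_group_add \<Rightarrow> 'c::ab_group_add \<Rightarrow> 'f::field_char_0"
  assumes P: "sign_orbit_family G \<rho> M \<sigma> N r P" and ab: "a \<in> M" "b \<in> N"
  shows "formal_combination r x P a b = 0 \<or>
    (\<exists>i\<in>x ` {1..r}. formal_combination r x P a b = indet i \<or>
       formal_combination r x P a b = - indet i)"
proof (cases "\<exists>i\<in>{1..r}. P i a b \<noteq> 0")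
  case False
  then show ?thesis
    by (simp add: formal_combination_def)
next
  case True
  then obtain i where i: "i \<in> {1..r}" "P i a b \<noteq> 0"
    by blast
  have disj: "disjoint_family_on (\<lambda>i. mat_support (P i)) {1..r}"
    using P unfolding sign_orbit_family_def by blast
  have "P j a b = 0" if "j \<in> {1..r}" "j \<noteq> i" for j
    using disjoint_family_onD[OF disj that(1) i(1) that(2)] i(2)
    by (auto simp: mat_support_def)
  then have "formal_combination r x P a b =
      (\<Sum>j=1..r. if j = i then indet (x i) * of_int (the_inv (of_int :: int \<Rightarrow> 'f) (P i a b)) else 0)"
    unfolding formal_combination_def by (intro sum.cong) auto
  also have "\<dots> = indet (x i) * of_int (the_inv (of_int :: int \<Rightarrow> 'f) (P i a b))"
    using i(1) by simp
  finally have eq: "formal_combination r x P a b =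
      indet (x i) * of_int (the_inv (of_int :: int \<Rightarrow> 'f) (P i a b))" .
  have "P i a b = 1 \<or> P i a b = - 1"
    using P ab i unfolding sign_orbit_family_def by blast
  then show ?thesis
    using eq i(1) by auto
qed

text \<open>Orthogonality is obtained over the field but is needed over the integers. It descends
  because \<open>of_int\<close> is injective in characteristic zero.\<close>

lemma sum_the_inv_of_int_mult:
  fixes f h :: "'k \<Rightarrow> 'f::ring_char_0"
  assumes "\<And>k. k \<in> K \<Longrightarrow> f k \<in> \<int>" "\<And>k. k \<in> K \<Longrightarrow> h k \<in> \<int>" "(\<Sum>k\<in>K. f k * h k) = 0"
  shows "(\<Sum>k\<in>K. the_inv (of_int :: int \<Rightarrow> 'f) (f k) * the_inv (of_int :: int \<Rightarrow> 'f) (h k)) = 0"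
proof -
  have inv: "of_int (the_inv (of_int :: int \<Rightarrow> 'f) z) = z" if "z \<in> \<int>" for z :: 'f
    using that by (auto elim: Ints_cases)
  have "(of_int (\<Sum>k\<in>K. the_inv (of_int :: int \<Rightarrow> 'f) (f k) * the_inv (of_int :: int \<Rightarrow> 'f) (h k)) :: 'f)
      = (\<Sum>k\<in>K. f k * h k)"
    using assms(1,2) by (auto simp: inv intro!: sum.cong)
  then show ?thesis
    using assms(3) by (simp only: of_int_eq_0_iff)
qed

text \<open>Integers are central, so they can be collected to the right of each word
  \<open>x i\<close>, \<open>y j\<close> without commuting any indeterminates. The coefficient of
  that word is then the integer version of the sum in \<open>zero\<close>.\<close>

lemma formal_combination_mult_transpose:
  fixes P :: "nat \<Rightarrow> 'r \<Rightarrow> 'k \<Rightarrow> 'f::field_char_0" and Q :: "nat \<Rightarrow> 's \<Rightarrow> 'k \<Rightarrow> 'f"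
  assumes P: "\<And>i k. i \<in> {1..r} \<Longrightarrow> k \<in> K \<Longrightarrow> P i a k \<in> \<int>"
    and Q: "\<And>j k. j \<in> {1..s} \<Longrightarrow> k \<in> K \<Longrightarrow> Q j b k \<in> \<int>"
    and zero: "\<And>i j. i \<in> {1..r} \<Longrightarrow> j \<in> {1..s} \<Longrightarrow> (\<Sum>k\<in>K. P i a k * Q j b k) = 0"
  shows "mat_mult K (formal_combination r x P) (mat_transpose (formal_combination s y Q)) a b = 0"
proof -
  define c where "c = the_inv (of_int :: int \<Rightarrow> 'f)"
  have term_eq: "indet (x i) * of_int m * (indet (y j) * of_int n) =
      indet (x i) * indet (y j) * of_int (m * n)" for i j m n
  proof -
    have "indet (x i) * of_int m * (indet (y j) * of_int n) =
        indet (x i) * (of_int m * indet (y j)) * of_int n"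
      by (simp only: mult.assoc)
    also have "of_int m * indet (y j) = indet (y j) * of_int m"
      by (rule mult_of_int_commute)
    finally show ?thesis
      by (simp only: mult.assoc of_int_mult)
  qed
  have "mat_mult K (formal_combination r x P) (mat_transpose (formal_combination s y Q)) a b =
      (\<Sum>k\<in>K. \<Sum>i=1..r. \<Sum>j=1..s. indet (x i) * indet (y j) * of_int (c (P i a k) * c (Q j b k)))"
    unfolding mat_mult_def mat_transpose_def formal_combination_def sum_product term_eq c_def ..
  also have "\<dots> = (\<Sum>i=1..r. \<Sum>j=1..s. \<Sum>k\<in>K.
      indet (x i) * indet (y j) * of_int (c (P i a k) * c (Q j b k)))"
    \<comment> \<open>Two exchanges move the sum over \<open>k\<close> innermost, past
      \<open>i\<close> and then past \<open>j\<close>.\<close>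
    by (subst sum.swap, intro sum.cong refl, rule sum.swap)
  also have "\<dots> = (\<Sum>i=1..r. \<Sum>j=1..s.
      indet (x i) * indet (y j) * of_int (\<Sum>k\<in>K. c (P i a k) * c (Q j b k)))"
    by (simp only: of_int_sum sum_distrib_left)
  also have "\<dots> = 0"
  proof (intro sum.neutral ballI)
    fix i j assume ij: "i \<in> {1..r}" "j \<in> {1..s}"
    then have "(\<Sum>k\<in>K. c (P i a k) * c (Q j b k)) = 0"
      unfolding c_def by (intro sum_the_inv_of_int_mult P Q zero)
    then show "indet (x i) * indet (y j) * of_int (\<Sum>k\<in>K. c (P i a k) * c (Q j b k)) = 0"
      by simp
  qed
  finally show ?thesis .
qed

theorem corollary2p10:
  fixes G :: "('g, 'e) monoid_scheme"
    and \<omega> :: "'g \<Rightarrow> 'g \<Rightarrow> 'f::field_char_0"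
    and sW :: "'f \<Rightarrow> 'w::ab_group_add \<Rightarrow> 'w" and \<rho>W :: "'g \<Rightarrow> 'w \<Rightarrow> 'w" and MW :: "'w set"
    and sV :: "'f \<Rightarrow> 'v::ab_group_add \<Rightarrow> 'v" and \<rho>V :: "'g \<Rightarrow> 'v \<Rightarrow> 'v" and MV :: "'v set"
    and sV' :: "'f \<Rightarrow> 'u::ab_group_add \<Rightarrow> 'u" and \<rho>V' :: "'g \<Rightarrow> 'u \<Rightarrow> 'u" and MV' :: "'u set"
    and r s :: nat
    and P :: "nat \<Rightarrow> 'v \<Rightarrow> 'w \<Rightarrow> 'f" and Q :: "nat \<Rightarrow> 'u \<Rightarrow> 'w \<Rightarrow> 'f"
    and x y :: "nat \<Rightarrow> 'x"
    and A :: "'v \<Rightarrow> 'w \<Rightarrow> 'x free_ring" and B :: "'u \<Rightarrow> 'w \<Rightarrow> 'x free_ring"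
  assumes "projective_monomial_rep G sW \<omega> \<rho>W MW"
    and "projective_monomial_rep G sV \<omega> \<rho>V MV"
    and "projective_monomial_rep G sV' \<omega> \<rho>V' MV'"
    and "Hom_M G sV \<rho>V MV sV' \<rho>V' MV' = {0}"
    and "is_basis_family (Hom_M G sW \<rho>W MW sV \<rho>V MV) r P"
    and "sign_orbit_family G \<rho>V MV \<rho>W MW r P"
    and "is_basis_family (Hom_M G sW \<rho>W MW sV' \<rho>V' MV') s Q"
    and "sign_orbit_family G \<rho>V' MV' \<rho>W MW s Q"
    and "inj_on x {1..r}" and "inj_on y {1..s}" and "x ` {1..r} \<inter> y ` {1..s} = {}"
    and "A = formal_combination r x P"
    and "B = formal_combination s y Q"
  shows "formal_orthogonal_pair (x ` {1..r}) (y ` {1..s}) MV MV' MW A B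
    \<and> (\<forall>v\<in>MV. \<forall>v'\<in>MV'. mat_mult MW A (mat_transpose B) v v' = 0)"
proof -
  have P: "P i \<in> Hom_M G sW \<rho>W MW sV \<rho>V MV" if "i \<in> {1..r}" for i
    using assms(5) that matrices.span_superset unfolding is_basis_family_def by blast
  have Q: "Q j \<in> Hom_M G sW \<rho>W MW sV' \<rho>V' MV'" if "j \<in> {1..s}" for j
    using assms(7) that matrices.span_superset unfolding is_basis_family_def by blast
  have P_int: "P i a k \<in> \<int>" if "i \<in> {1..r}" "a \<in> MV" "k \<in> MW" for i a k
  proof -
    have "P i a k \<in> {0, -1, 1}"
      using assms(6) that unfolding sign_orbit_family_def by blast
    then show ?thesis by auto
  qed
  have Q_int: "Q j b k \<in> \<int>" if "j \<in> {1..s}" "b \<in> MV'" "k \<in> MW" for j b k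
  proof -
    have "Q j b k \<in> {0, -1, 1}"
      using assms(8) that unfolding sign_orbit_family_def by blast
    then show ?thesis by auto
  qed
  have orth: "(\<Sum>k\<in>MW. P i a k * Q j b k) = 0"
    if "i \<in> {1..r}" "j \<in> {1..s}" "a \<in> MV" "b \<in> MV'" for i j a b
  proof -
    \<comment> \<open>The hypothesis concerns maps from V to V', so it kills the product of
      \<open>Q j\<close> with the transpose of \<open>P i\<close>. The desired sum is its entry at
      \<open>(b, a)\<close>, with the factors exchanged in the commutative field.\<close>
    have "(\<lambda>b a. if b \<in> MV' \<and> a \<in> MV
        then mat_mult MW (Q j) (mat_transpose (P i)) b a else 0) = 0"
      using Hom_M_mult_transpose[OF assms(1,2,3) P[OF that(1)] Q[OF that(2)]] assms(4) by simp
    then have "mat_mult MW (Q j) (mat_transpose (P i)) b a = 0"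
      using that(3,4) by (auto simp: fun_eq_iff split: if_splits)
    then show ?thesis
      by (simp add: mat_mult_def mat_transpose_def mult.commute)
  qed
  have "mat_mult MW A (mat_transpose B) a b = 0" if "a \<in> MV" "b \<in> MV'" for a b
    unfolding assms(12,13)
    using that by (intro formal_combination_mult_transpose P_int Q_int orth)
  moreover have "finite MV" "finite MV'" "finite MW"
    using assms(1-3) by (blast dest: projective_monomial_rep.finite_basis)+
  ultimately show ?thesis
    using formal_combination_entry[OF assms(6), of _ _ x]
      formal_combination_entry[OF assms(8), of _ _ y] assms(11)
    unfolding formal_orthogonal_pair_def assms(12,13) by blast
qed

end
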